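(* Let $a\in(\mathbb{R}^+)^n$ and let $f:\Omega=\{-1,1\}^n\to\mathbb{R}$ be an $a$-Lipschitz function. If an interaction matrix $L$ (with corresponding Ising measure $\pi_L$) satisfies the Dobrushin-like condition $\|(|L|)\|_2<1$, then for any other interaction matrix $M$ (with corresponding Ising measure $\pi_M$), $$|\mathbb{E}_{\pi_L}f-\mathbb{E}_{\pi_M}f|\le\frac{\|a\|_2\sqrt n}{2\big(1-\|(|L|)\|_2\big)}\,\|L-M\|_2.$$
   Context: An interaction matrix $J$ is a real symmetric $n\times n$ matrix with zero diagonal (entries may have either sign). The Ising measure with interaction matrix $J$ is the probability measure $\pi_J$ on $\Omega=\{-1,1\}^n$ with $\pi_J(x)\propto\exp\big(\tfrac12x^{\intercal}Jx\big)$. $|L|$ denotes the matrix of entrywise absolute values, $(|L|)_{ij}=|L_{ij}|$. For matrices $\|\cdot\|_2$ is the spectral (operator) norm; for vectors it is the Euclidean norm. $\mathbb{R}^+$ denotes the positive reals. A function $f:\Omega\to\mathbb{R}$ is $a$-Lipschitz if $|f(x)-f(y)|\le\sum_{i=1}^na_i\mathbf 1_{x_i\ne y_i}$ for all $x,y\in\Omega$. *)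

theory Defs
  imports "HOL-Probability.Probability"
begin

definition interaction_matrix :: "real ^ 'n ^ 'n \<Rightarrow> bool" where
  "interaction_matrix J \<longleftrightarrow> transpose J = J \<and> (\<forall>i. J $ i $ i = 0)"

definition spins :: "(real ^ 'n) set" where
  "spins = {x. \<forall>i. x $ i \<in> {-1, 1}}"

definition ising_weight :: "real ^ 'n ^ 'n \<Rightarrow> real ^ 'n \<Rightarrow> real" where
  "ising_weight J x = (if x \<in> spins then exp (1/2 * (x \<bullet> (J *v x))) else 0)"

text \<open>
  The Ising measure lives on the whole space \<^typ>\<open>real ^ 'n\<close> but is supported on
  \<^const>\<open>spins\<close>; \<open>pmf_ising_pmf\<close> and \<open>set_pmf_ising_pmf\<close> below confirm that
  \<^const>\<open>embed_pmf\<close> is applied to a genuine probability mass function.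
\<close>

definition ising_pmf :: "real ^ 'n ^ 'n \<Rightarrow> (real ^ 'n) pmf" where
  "ising_pmf J = embed_pmf (\<lambda>x. ising_weight J x / (\<Sum>y\<in>spins. ising_weight J y))"

definition lipschitz_spins :: "real ^ 'n \<Rightarrow> (real ^ 'n \<Rightarrow> real) \<Rightarrow> bool" where
  "lipschitz_spins a f \<longleftrightarrow>
     (\<forall>x\<in>spins. \<forall>y\<in>spins. \<bar>f x - f y\<bar> \<le> (\<Sum>i\<in>UNIV. a $ i * of_bool (x $ i \<noteq> y $ i)))"

definition abs_matrix :: "real ^ 'n ^ 'm \<Rightarrow> real ^ 'n ^ 'm" where
  "abs_matrix A = (\<chi> i j. \<bar>A $ i $ j\<bar>)"

definition spectral_norm :: "real ^ 'n ^ 'm \<Rightarrow> real" where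
  "spectral_norm A = onorm ((*v) A)"

lemma finite_spins: "finite (spins :: (real ^ 'n) set)"
proof -
  have "finite (vec_lambda ` (Pi\<^sub>E (UNIV :: 'n set) (\<lambda>_. {-1, 1 :: real})))"
    by (intro finite_imageI finite_PiE) auto
  moreover have "spins \<subseteq> vec_lambda ` (Pi\<^sub>E (UNIV :: 'n set) (\<lambda>_. {-1, 1 :: real}))"
  proof
    fix x :: "real ^ 'n"
    assume "x \<in> spins"
    then have "vec_nth x \<in> Pi\<^sub>E UNIV (\<lambda>_. {-1, 1})"
      by (auto simp: spins_def PiE_def)
    then show "x \<in> vec_lambda ` (Pi\<^sub>E UNIV (\<lambda>_. {-1, 1}))"
      by (metis image_eqI vec_lambda_eta)
  qed
  ultimately show ?thesis
    by (rule finite_subset[rotated])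
qed

lemma ising_partition_pos: "(\<Sum>y\<in>spins. ising_weight J y) > 0"
proof -
  have "(\<chi> i. 1) \<in> (spins :: (real ^ 'n) set)"
    by (simp add: spins_def)
  then show ?thesis
    by (intro sum_pos finite_spins) (auto simp: ising_weight_def)
qed

lemma pmf_ising_pmf:
  "pmf (ising_pmf J) x = ising_weight J x / (\<Sum>y\<in>spins. ising_weight J y)"
proof -
  let ?Z = "\<Sum>y\<in>spins. ising_weight J y"
  let ?p = "\<lambda>x. ising_weight J x / ?Z"
  have nonneg: "?p x \<ge> 0" for x
    using ising_partition_pos[of J] by (simp add: ising_weight_def)
  have "(\<integral>\<^sup>+ x. ennreal (?p x) \<partial>count_space UNIV) = (\<Sum>x\<in>spins. ennreal (?p x))"
    by (rule nn_integral_count_space') (auto simp: finite_spins ising_weight_def)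
  also have "\<dots> = ennreal (\<Sum>x\<in>spins. ?p x)"
    using nonneg by (simp add: sum_ennreal)
  also have "(\<Sum>x\<in>spins. ?p x) = 1"
    using ising_partition_pos[of J] by (simp flip: sum_divide_distrib)
  finally have "(\<integral>\<^sup>+ x. ennreal (?p x) \<partial>count_space UNIV) = 1"
    by simp
  then show ?thesis
    unfolding ising_pmf_def using nonneg by (intro pmf_embed_pmf) auto
qed

lemma set_pmf_ising_pmf: "set_pmf (ising_pmf J) = spins"
  using ising_partition_pos[of J] by (auto simp: set_pmf_iff pmf_ising_pmf ising_weight_def split: if_splits)

end

theory Submission
  imports Defs
begin

text \<open>
  Let \<open>P\<close> be one step of the random-scan Glauber dynamics for \<open>\<pi>\<^sub>L\<close>. If \<open>f\<close> is \<open>v\<close>-Lipschitz, then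
  \<open>P f\<close> is \<open>B v\<close>-Lipschitz with \<open>B = (1 - 1/n) I + |L|/n\<close>, whose norm \<open>\<rho> = 1 - (1 - \<parallel>|L|\<parallel>)/n\<close> is below
  one. Since \<open>\<pi>\<^sub>M\<close> is invariant under its own dynamics \<open>Q\<close>, and \<open>P f\<close> and \<open>Q f\<close> differ pointwise by at
  most \<open>c \<parallel>v\<parallel>\<close> with \<open>c = \<parallel>L - M\<parallel> / (2 \<surd>n)\<close> (the conditional mean of spin \<open>i\<close> is
  \<open>tanh (J x)\<^sub>i\<close>, and \<open>tanh\<close> is 1-Lipschitz), the discrepancy \<open>D f = |E\<^sub>L f - E\<^sub>M f|\<close> satisfies
  \<open>D f \<le> D (P f) + c \<parallel>v\<parallel>\<close>. Iterating gives \<open>D f \<le> c \<parallel>v\<parallel> / (1 - \<rho>)\<close>.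
\<close>

section \<open>Elementary estimates for tanh and norms\<close>

lemma tanh_diff_le: "\<bar>tanh x - tanh y\<bar> \<le> \<bar>x - y :: real\<bar>"
proof -
  have *: "tanh v - tanh u \<le> v - u" if "u \<le> v" for u v :: real
  proof -
    have "u - tanh u \<le> v - tanh v"
      using that
    proof (rule DERIV_nonneg_imp_nondecreasing)
      fix t :: real
      have "((\<lambda>t. t - tanh t) has_real_derivative (tanh t)\<^sup>2) (at t)"
        by (auto intro!: derivative_eq_intros)
      then show "\<exists>d. ((\<lambda>t. t - tanh t) has_real_derivative d) (at t) \<and> 0 \<le> d"
        by auto
    qed
    then show ?thesis by simp
  qed
  have "tanh u \<le> tanh v" if "u \<le> v" for u v :: real
    using that by simp
  then show ?thesis
    using *[of x y] *[of y x] by (cases "x \<le> y") (auto simp: abs_if not_le)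
qed

lemma norm_matrix_vector_mul_le: "norm (A *v x) \<le> spectral_norm A * norm x"
  unfolding spectral_norm_def by (rule onorm) (rule matrix_vector_mul_bounded_linear)

lemma spectral_norm_nonneg: "spectral_norm A \<ge> 0"
  unfolding spectral_norm_def by (rule onorm_pos_le) (rule matrix_vector_mul_bounded_linear)

lemma norm_spins:
  fixes x :: "real ^ 'n"
  assumes "x \<in> spins"
  shows "norm x = sqrt (real CARD('n))"
proof -
  have "(norm (x $ i))\<^sup>2 = 1" for i
    using assms by (auto simp: spins_def dest!: spec[of _ i])
  then show ?thesis by (simp add: norm_vec_def L2_set_def)
qed

section \<open>Single-spin changes and the coordinatewise Lipschitz condition\<close>

definition set_spin :: "real ^ 'n \<Rightarrow> 'n \<Rightarrow> real \<Rightarrow> real ^ 'n" where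
  "set_spin x i s = (\<chi> j. if j = i then s else x $ j)"

lemma set_spin_nth: "set_spin x i s $ j = (if j = i then s else x $ j)"
  by (simp add: set_spin_def)

lemma set_spin_self [simp]: "set_spin x i (x $ i) = x"
  by (simp add: vec_eq_iff set_spin_nth)

lemma set_spin_overwrite [simp]: "set_spin (set_spin x i s) i t = set_spin x i t"
  by (simp add: vec_eq_iff set_spin_nth)

lemma set_spin_commute: "i \<noteq> j \<Longrightarrow> set_spin (set_spin x i s) j t = set_spin (set_spin x j t) i s"
  by (auto simp: vec_eq_iff set_spin_nth)

lemma set_spin_in_spins: "x \<in> spins \<Longrightarrow> s \<in> {-1, 1} \<Longrightarrow> set_spin x i s \<in> spins"
  by (auto simp: spins_def set_spin_nth)

lemma set_spin_eq_add: "set_spin x i s = set_spin x i t + (s - t) *\<^sub>R axis i 1"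
  by (auto simp: vec_eq_iff set_spin_nth axis_def)

lemma spins_cases: "x \<in> spins \<Longrightarrow> x $ i = 1 \<or> x $ i = -1"
  by (auto simp: spins_def)

lemma matrix_vector_mult_set_spin:
  fixes J :: "real ^ 'n ^ 'm"
  shows "(J *v set_spin x i s) $ j = (J *v set_spin x i t) $ j + (s - t) * J $ j $ i"
  by (subst set_spin_eq_add[of x i s t])
    (simp add: matrix_vector_right_distrib matrix_vector_mult_scaleR matrix_vector_mult_basis column_def)

text \<open>Reduces the Lipschitz condition to pairs that differ in one spin, the form in which a
  single-site update can be analysed. The converse telescopes along a path from x to y that corrects
  one coordinate at a time.\<close>

lemma lipschitz_spins_iff:
  fixes v :: "real ^ 'n"
  shows "lipschitz_spins v f \<longleftrightarrow>
    (\<forall>x\<in>spins. \<forall>i. \<bar>f (set_spin x i 1) - f (set_spin x i (-1))\<bar> \<le> v $ i)"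
proof
  assume lip: "lipschitz_spins v f"
  show "\<forall>x\<in>spins. \<forall>i. \<bar>f (set_spin x i 1) - f (set_spin x i (-1))\<bar> \<le> v $ i"
  proof (intro ballI allI)
    fix x :: "real ^ 'n" and i assume "x \<in> spins"
    then have "\<bar>f (set_spin x i 1) - f (set_spin x i (-1))\<bar>
        \<le> (\<Sum>j\<in>UNIV. v $ j * of_bool (set_spin x i 1 $ j \<noteq> set_spin x i (-1) $ j))"
      using lip by (auto simp: lipschitz_spins_def set_spin_in_spins)
    also have "\<dots> = (\<Sum>j\<in>UNIV. if j = i then v $ j else 0)"
      by (intro sum.cong) (auto simp: set_spin_nth)
    finally show "\<bar>f (set_spin x i 1) - f (set_spin x i (-1))\<bar> \<le> v $ i"
      by simp
  qed
next
  assume coord: "\<forall>x\<in>spins. \<forall>i. \<bar>f (set_spin x i 1) - f (set_spin x i (-1))\<bar> \<le> v $ i"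
  \<comment> \<open>S contains every coordinate still to be corrected. The start x must vary in the
    induction, because each step moves it to \<open>?z\<close>.\<close>
  have path: "\<bar>f x - f y\<bar> \<le> (\<Sum>i\<in>S. v $ i * of_bool (x $ i \<noteq> y $ i))"
    if "finite S" "x \<in> spins" "y \<in> spins" "\<And>i. i \<notin> S \<Longrightarrow> x $ i = y $ i" for S x y
    using that
  proof (induction S arbitrary: x rule: finite_induct)
    case empty
    then have "x = y" by (simp add: vec_eq_iff)
    then show ?case by simp
  next
    case (insert i S)
    let ?z = "set_spin x i (y $ i)"
    have z: "?z \<in> spins"
      using insert.prems spins_cases[of y i] by (auto intro!: set_spin_in_spins)
    have "\<bar>f ?z - f y\<bar> \<le> (\<Sum>j\<in>S. v $ j * of_bool (?z $ j \<noteq> y $ j))"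
      using insert.prems z by (intro insert.IH) (auto simp: set_spin_nth)
    also have "\<dots> = (\<Sum>j\<in>S. v $ j * of_bool (x $ j \<noteq> y $ j))"
      using insert.hyps by (intro sum.cong) (auto simp: set_spin_nth)
    finally have rest: "\<bar>f ?z - f y\<bar> \<le> \<dots>" .
    have "\<bar>f x - f ?z\<bar> \<le> v $ i * of_bool (x $ i \<noteq> y $ i)"
    proof (cases "x $ i = y $ i")
      case True
      then have "?z = x" by (metis set_spin_self)
      then show ?thesis using True by simp
    next
      case False
      have "\<bar>f (set_spin x i 1) - f (set_spin x i (-1))\<bar> \<le> v $ i"
        using coord insert.prems by blast
      moreover have "f x = f (set_spin x i (x $ i))" by simp
      ultimately show ?thesis
        using False spins_cases[of x i] spins_cases[of y i] insert.prems
        by (auto simp del: set_spin_self)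
    qed
    with rest show ?case
      unfolding sum.insert[OF insert.hyps] by linarith
  qed
  show "lipschitz_spins v f"
    unfolding lipschitz_spins_def using path[of UNIV] by simp
qed

section \<open>Heat-bath updates and invariance of the Ising measure\<close>

lemma sum_spins_set_spin:
  fixes g :: "real ^ 'n \<Rightarrow> real"
  shows "(\<Sum>x\<in>spins. g (set_spin x i 1) + g (set_spin x i (-1))) = 2 * (\<Sum>x\<in>spins. g x)"
proof -
  have "(\<Sum>x\<in>spins. g (set_spin x i 1) + g (set_spin x i (-1)))
      = (\<Sum>x\<in>spins. g x + g (set_spin x i (- x $ i)))"
  proof (rule sum.cong)
    fix x :: "real ^ 'n" assume "x \<in> spins"
    moreover have "g x = g (set_spin x i (x $ i))" by simp
    ultimately show "g (set_spin x i 1) + g (set_spin x i (-1)) = g x + g (set_spin x i (- x $ i))"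
      using spins_cases[of x i] by (auto simp del: set_spin_self)
  qed simp
  \<comment> \<open>Flipping spin i is an involution of \<open>spins\<close>, so it only permutes
    the summands.\<close>
  also have "(\<Sum>x\<in>spins. g (set_spin x i (- x $ i))) = (\<Sum>x\<in>spins. g x)"
  proof (rule sum.reindex_bij_witness[where i = "\<lambda>x. set_spin x i (- x $ i)" and j = "\<lambda>x. set_spin x i (- x $ i)"])
    show "set_spin x i (- x $ i) \<in> spins" if "x \<in> spins" for x :: "real ^ 'n"
      using that spins_cases[of x i] by (auto intro!: set_spin_in_spins)
    then show "set_spin x i (- x $ i) \<in> spins" if "x \<in> spins" for x :: "real ^ 'n"
      using that .
  qed (auto simp: set_spin_nth)
  ultimately show ?thesis by (simp add: sum.distrib)
qed

text \<open>The expectation of f after spin i is resampled from its conditional law under J given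
  the other spins: with local field m = (J x)_i, the values 1 and -1 have probabilities (1 + tanh
  m)/2 and (1 - tanh m)/2. In this form J enters only through the tanh factor.\<close>

definition heat_bath :: "real ^ 'n ^ 'n \<Rightarrow> 'n \<Rightarrow> (real ^ 'n \<Rightarrow> real) \<Rightarrow> real ^ 'n \<Rightarrow> real" where
  "heat_bath J i f x =
     (f (set_spin x i 1) + f (set_spin x i (-1))) / 2
     + tanh ((J *v x) $ i) * (f (set_spin x i 1) - f (set_spin x i (-1))) / 2"

definition glauber :: "real ^ 'n ^ 'n \<Rightarrow> (real ^ 'n \<Rightarrow> real) \<Rightarrow> real ^ 'n \<Rightarrow> real" where
  "glauber J f x = (\<Sum>i\<in>UNIV. heat_bath J i f x) / real CARD('n)"

text \<open>The zero diagonal makes the local field at i independent of spin i, so the resampling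
  law depends on the other spins alone.\<close>

lemma matrix_vector_mult_set_spin_diag:
  fixes J :: "real ^ 'n ^ 'n"
  assumes "interaction_matrix J"
  shows "(J *v set_spin x i s) $ i = (J *v x) $ i"
  using matrix_vector_mult_set_spin[of J x i s i "x $ i"] assms
  by (simp add: interaction_matrix_def)

lemma heat_bath_set_spin:
  assumes "interaction_matrix J"
  shows "heat_bath J i f (set_spin x i s) = heat_bath J i f x"
  by (simp add: heat_bath_def matrix_vector_mult_set_spin_diag[OF assms])

text \<open>The odds that fix the conditional law of spin i. Raising it from -1 to 1 adds 2 e_i; by
  symmetry the cross terms contribute 4 (J x)_i to the quadratic form, the e_i term vanishes by the
  zero diagonal, and the factor 1/2 in the weight leaves 2 (J x)_i.\<close>

lemma ising_weight_ratio:
  fixes J :: "real ^ 'n ^ 'n"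
  assumes J: "interaction_matrix J" and x: "x \<in> spins"
  shows "ising_weight J (set_spin x i 1) = exp (2 * (J *v x) $ i) * ising_weight J (set_spin x i (-1))"
proof -
  let ?y = "set_spin x i (-1)"
  have sym: "u \<bullet> (J *v w) = w \<bullet> (J *v u)" for u w
    using J by (metis dot_lmul_matrix inner_commute interaction_matrix_def vector_transpose_matrix)
  have e: "set_spin x i 1 = ?y + 2 *\<^sub>R axis i 1"
    using set_spin_eq_add[of x i 1 "-1"] by simp
  have d: "axis i 1 \<bullet> (J *v axis i 1) = 0"
    using J by (simp add: inner_axis' matrix_vector_mult_basis column_def interaction_matrix_def)
  have m: "axis i 1 \<bullet> (J *v ?y) = (J *v x) $ i"
    by (simp add: inner_axis' matrix_vector_mult_set_spin_diag[OF J])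
  have "set_spin x i 1 \<bullet> (J *v set_spin x i 1) = ?y \<bullet> (J *v ?y) + 4 * (J *v x) $ i"
    unfolding e using d m sym[of ?y "axis i 1"]
    by (simp add: matrix_vector_right_distrib matrix_vector_mult_scaleR inner_add_left inner_add_right)
  then show ?thesis
    using x by (simp add: ising_weight_def set_spin_in_spins add_divide_distrib mult_exp_exp)
qed

lemma expectation_ising_pmf:
  "measure_pmf.expectation (ising_pmf J) f
    = (\<Sum>x\<in>spins. ising_weight J x * f x) / (\<Sum>y\<in>spins. ising_weight J y)"
  by (subst integral_measure_pmf[of spins])
    (auto simp: finite_spins set_pmf_ising_pmf pmf_ising_pmf sum_divide_distrib)

lemma integrable_ising_pmf [simp, intro]: "integrable (measure_pmf (ising_pmf J)) (f :: _ \<Rightarrow> real)"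
  by (rule integrable_measure_pmf_finite) (simp add: set_pmf_ising_pmf finite_spins)

lemma abs_expectation_ising_le:
  fixes g :: "real ^ 'n \<Rightarrow> real"
  assumes "\<And>x. x \<in> spins \<Longrightarrow> \<bar>g x\<bar> \<le> c"
  shows "\<bar>measure_pmf.expectation (ising_pmf J) g\<bar> \<le> c"
proof -
  have "\<bar>measure_pmf.expectation (ising_pmf J) g\<bar> \<le> measure_pmf.expectation (ising_pmf J) (\<lambda>x. \<bar>g x\<bar>)"
    by (rule integral_abs_bound)
  also have "\<dots> \<le> c"
    using assms by (intro measure_pmf.integral_le_const) (auto simp: AE_measure_pmf_iff set_pmf_ising_pmf)
  finally show ?thesis .
qed

lemma expectation_heat_bath:
  assumes J: "interaction_matrix J"
  shows "measure_pmf.expectation (ising_pmf J) (heat_bath J i f) = measure_pmf.expectation (ising_pmf J) f"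
proof -
  let ?w = "ising_weight J"
  have "?w (set_spin x i 1) * heat_bath J i f (set_spin x i 1)
        + ?w (set_spin x i (-1)) * heat_bath J i f (set_spin x i (-1))
      = ?w (set_spin x i 1) * f (set_spin x i 1) + ?w (set_spin x i (-1)) * f (set_spin x i (-1))"
    if x: "x \<in> spins" for x
  proof -
    let ?m = "(J *v x) $ i"
    \<comment> \<open>E is the weight ratio of plus to minus, so (1 + tanh m)/2 = E/(E + 1) is the
      conditional probability of plus.\<close>
    define E where "E = exp (2 * ?m)"
    have "tanh ?m = (E - 1) / (E + 1)"
      unfolding E_def by (simp add: tanh_real_altdef exp_minus divide_simps)
    moreover have "E + 1 > 0" by (simp add: E_def add_pos_pos)
    ultimately have T: "tanh ?m * (E + 1) = E - 1"
      by simp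
    have "(E + 1) * heat_bath J i f x = ((E + 1) * (f (set_spin x i 1) + f (set_spin x i (-1)))
        + tanh ?m * (E + 1) * (f (set_spin x i 1) - f (set_spin x i (-1)))) / 2"
      by (simp add: heat_bath_def field_simps)
    also have "\<dots> = E * f (set_spin x i 1) + f (set_spin x i (-1))"
      unfolding T by (simp add: field_simps)
    finally have "?w (set_spin x i (-1)) * ((E + 1) * heat_bath J i f x)
        = ?w (set_spin x i (-1)) * (E * f (set_spin x i 1) + f (set_spin x i (-1)))"
      by (rule arg_cong)
    then show ?thesis
      unfolding heat_bath_set_spin[OF J] ising_weight_ratio[OF J x] E_def[symmetric]
      by (simp add: algebra_simps)
  qed
  \<comment> \<open>Doubling lets both sums run over pairs differing at spin i, on which the two
    summands have just been shown to agree.\<close>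
  then have "2 * (\<Sum>x\<in>spins. ?w x * heat_bath J i f x) = 2 * (\<Sum>x\<in>spins. ?w x * f x)"
    unfolding sum_spins_set_spin[where i = i, symmetric] by (intro sum.cong) auto
  then show ?thesis by (simp add: expectation_ising_pmf)
qed

lemma expectation_glauber:
  assumes "interaction_matrix J"
  shows "measure_pmf.expectation (ising_pmf J) (glauber J f) = measure_pmf.expectation (ising_pmf J) f"
  unfolding glauber_def by (simp add: Bochner_Integration.integral_sum expectation_heat_bath[OF assms])

section \<open>One-step estimates: perturbation of the matrix and contraction\<close>

lemma glauber_diff_le:
  fixes L M :: "real ^ 'n ^ 'n"
  assumes f: "lipschitz_spins v f" and x: "x \<in> spins"
  shows "\<bar>glauber L f x - glauber M f x\<bar>
    \<le> spectral_norm (L - M) * sqrt (real CARD('n)) / (2 * real CARD('n)) * norm v"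
proof -
  have "\<bar>heat_bath L i f x - heat_bath M i f x\<bar> \<le> \<bar>((L - M) *v x) $ i\<bar> * \<bar>v $ i\<bar> / 2" for i
  proof -
    have eq: "heat_bath L i f x - heat_bath M i f x
        = (tanh ((L *v x) $ i) - tanh ((M *v x) $ i)) * (f (set_spin x i 1) - f (set_spin x i (-1))) / 2"
      by (simp add: heat_bath_def field_simps)
    have "\<bar>tanh ((L *v x) $ i) - tanh ((M *v x) $ i)\<bar> \<le> \<bar>((L - M) *v x) $ i\<bar>"
      using tanh_diff_le by (simp add: matrix_vector_mult_diff_rdistrib)
    moreover have "\<bar>f (set_spin x i 1) - f (set_spin x i (-1))\<bar> \<le> \<bar>v $ i\<bar>"
      using f x unfolding lipschitz_spins_iff by (meson abs_ge_self order_trans)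
    ultimately show ?thesis
      unfolding eq by (simp add: abs_mult mult_mono del: vector_minus_component)
  qed
  then have "\<bar>\<Sum>i\<in>UNIV. heat_bath L i f x - heat_bath M i f x\<bar>
      \<le> (\<Sum>i\<in>UNIV. \<bar>((L - M) *v x) $ i\<bar> * \<bar>v $ i\<bar> / 2)"
    by (intro order_trans[OF sum_abs] sum_mono)
  also have "\<dots> = (\<Sum>i\<in>UNIV. \<bar>((L - M) *v x) $ i\<bar> * \<bar>v $ i\<bar>) / 2"
    by (simp add: sum_divide_distrib)
  \<comment> \<open>Cauchy-Schwarz; the factor \<open>sqrt n\<close> below is the norm of a spin
    configuration.\<close>
  also have "\<dots> \<le> norm ((L - M) *v x) * norm v / 2"
    using L2_set_mult_ineq[of "\<lambda>i. \<bar>((L - M) *v x) $ i\<bar>" "\<lambda>i. \<bar>v $ i\<bar>" UNIV]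
    by (simp add: norm_vec_def)
  also have "\<dots> \<le> (spectral_norm (L - M) * sqrt (real CARD('n))) * norm v / 2"
    using norm_matrix_vector_mul_le[of "L - M" x] by (simp add: norm_spins[OF x] mult_right_mono)
  finally show ?thesis
    by (simp add: glauber_def sum_subtractf divide_right_mono field_simps flip: diff_divide_distrib)
qed

text \<open>Let two configurations differ only at j. Updating j erases the difference. Updating i
  \<noteq> j keeps it, at cost v_j, and also shifts the local field at i by 2 L_ij, which costs at
  most |L_ij| v_i. Averaging over i gives the new vector.\<close>

lemma lipschitz_spins_glauber:
  fixes v :: "real ^ 'n" and L :: "real ^ 'n ^ 'n"
  assumes L: "interaction_matrix L" and f: "lipschitz_spins v f"
  shows "lipschitz_spins ((1 / real CARD('n)) *\<^sub>R ((real CARD('n) - 1) *\<^sub>R v + abs_matrix L *v v)) (glauber L f)"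
  unfolding lipschitz_spins_iff
proof (intro ballI allI)
  fix x :: "real ^ 'n" and j assume x: "x \<in> spins"
  let ?n = "real CARD('n)"
  let ?p = "set_spin x j 1" and ?m = "set_spin x j (-1)"
  have df: "\<bar>f (set_spin y i 1) - f (set_spin y i (-1))\<bar> \<le> v $ i" if "y \<in> spins" for y i
    using f that unfolding lipschitz_spins_iff by blast
  have bound: "\<bar>heat_bath L i f ?p - heat_bath L i f ?m\<bar>
      \<le> (if i = j then 0 else v $ j) + \<bar>L $ i $ j\<bar> * v $ i" for i
  proof (cases "i = j")
    case True
    then show ?thesis using L heat_bath_set_spin[OF L]
      by (simp add: interaction_matrix_def)
  next
    case False
    define tp tm where "tp = tanh ((L *v ?p) $ i)" and "tm = tanh ((L *v ?m) $ i)"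
    \<comment> \<open>The four values of f over spins j and i: a, b have spin j = 1 and c, d have
      spin j = -1; a, c have spin i = 1 and b, d have spin i = -1.\<close>
    define a b c d where "a = f (set_spin ?p i 1)" and "b = f (set_spin ?p i (-1))"
      and "c = f (set_spin ?m i 1)" and "d = f (set_spin ?m i (-1))"
    have "\<bar>tp - tm\<bar> \<le> 2 * \<bar>L $ i $ j\<bar>"
      unfolding tp_def tm_def
      using tanh_diff_le[of "(L *v ?p) $ i" "(L *v ?m) $ i"]
        matrix_vector_mult_set_spin[of L x j 1 i "-1"] by (simp add: abs_mult)
    moreover have "\<bar>c - d\<bar> \<le> v $ i"
      unfolding c_def d_def using x by (intro df set_spin_in_spins) auto
    ultimately have "\<bar>(tp - tm) * (c - d)\<bar> \<le> 2 * \<bar>L $ i $ j\<bar> * v $ i"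
      unfolding abs_mult by (intro mult_mono) auto
    moreover have ac: "\<bar>a - c\<bar> \<le> v $ j"
      unfolding a_def c_def using False df[of "set_spin x i 1" j] x
      by (simp add: set_spin_commute[of j i] set_spin_in_spins)
    moreover have bd: "\<bar>b - d\<bar> \<le> v $ j"
      unfolding b_def d_def using False df[of "set_spin x i (-1)" j] x
      by (simp add: set_spin_commute[of j i] set_spin_in_spins)
    \<comment> \<open>The weights 1 + tp and 1 - tp are nonnegative and sum to 2.\<close>
    moreover have "\<bar>(1 + tp) * (a - c) + (1 - tp) * (b - d)\<bar> \<le> 2 * v $ j"
    proof -
      have t: "\<bar>tp\<bar> \<le> 1"
        unfolding tp_def using tanh_real_bounds[of "(L *v ?p) $ i"] by (auto simp: abs_le_iff)
      have "\<bar>(1 + tp) * (a - c)\<bar> \<le> (1 + tp) * v $ j" "\<bar>(1 - tp) * (b - d)\<bar> \<le> (1 - tp) * v $ j"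
        using t ac bd by (auto simp: abs_mult intro!: mult_mono)
      then show ?thesis by (simp add: algebra_simps)
    qed
    \<comment> \<open>The first part compares the values of f under the same resampling law, the
      second the two laws on the same values.\<close>
    moreover have "heat_bath L i f ?p - heat_bath L i f ?m
        = ((1 + tp) * (a - c) + (1 - tp) * (b - d)) / 2 + (tp - tm) * (c - d) / 2"
      by (simp add: heat_bath_def flip: tp_def tm_def a_def b_def c_def d_def)
        (simp add: field_simps)
    moreover have "\<bar>u / 2 + w / 2\<bar> \<le> k + l" if "\<bar>u\<bar> \<le> 2 * k" "\<bar>w\<bar> \<le> 2 * l" for u w k l :: real
      using that abs_triangle_ineq[of "u / 2" "w / 2"] by simp
    ultimately show ?thesis using False by (simp only: if_False mult.assoc)
  qed
  have "\<bar>\<Sum>i\<in>UNIV. heat_bath L i f ?p - heat_bath L i f ?m\<bar>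
      \<le> (\<Sum>i\<in>UNIV. (if i = j then 0 else v $ j) + \<bar>L $ i $ j\<bar> * v $ i)"
    by (intro order_trans[OF sum_abs] sum_mono bound)
  also have "\<dots> = (?n - 1) * v $ j + (abs_matrix L *v v) $ j"
  proof -
    \<comment> \<open>Symmetry turns the sum down column j into row j of |L| applied to v.\<close>
    have "L $ i $ j = L $ j $ i" for i
      using L unfolding interaction_matrix_def transpose_def by (metis vec_lambda_beta)
    moreover have "(\<Sum>i\<in>UNIV. if i = j then 0 else v $ j) = (?n - 1) * v $ j"
    proof -
      have "(\<Sum>i\<in>UNIV. if i = j then 0 else v $ j) = (\<Sum>i\<in>UNIV. v $ j - (if i = j then v $ j else 0))"
        by (intro sum.cong) auto
      then show ?thesis by (simp add: sum_subtractf algebra_simps)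
    qed
    ultimately show ?thesis
      by (simp add: sum.distrib abs_matrix_def matrix_vector_mult_def)
  qed
  finally show "\<bar>glauber L f ?p - glauber L f ?m\<bar>
      \<le> ((1 / ?n) *\<^sub>R ((?n - 1) *\<^sub>R v + abs_matrix L *v v)) $ j"
    by (simp add: glauber_def sum_subtractf divide_right_mono flip: diff_divide_distrib)
qed

lemma norm_glauber_lipschitz_le:
  fixes v :: "real ^ 'n" and A :: "real ^ 'n ^ 'n"
  shows "norm ((1 / real CARD('n)) *\<^sub>R ((real CARD('n) - 1) *\<^sub>R v + A *v v))
    \<le> (1 - (1 - spectral_norm A) / real CARD('n)) * norm v"
proof -
  let ?n = "real CARD('n)"
  have n: "?n \<ge> 1" by (simp add: Suc_leI)
  have "norm ((?n - 1) *\<^sub>R v + A *v v) \<le> (?n - 1) * norm v + spectral_norm A * norm v"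
    using n norm_matrix_vector_mul_le[of A v] by (intro norm_triangle_le) simp
  then have "norm ((1 / ?n) *\<^sub>R ((?n - 1) *\<^sub>R v + A *v v))
      \<le> ((?n - 1) * norm v + spectral_norm A * norm v) / ?n"
    by (simp add: divide_right_mono)
  also have "\<dots> = (1 - (1 - spectral_norm A) / ?n) * norm v"
    by (simp add: field_simps)
  finally show ?thesis .
qed

section \<open>Comparison of expectations and iteration\<close>

lemma expectation_ising_diff_crude:
  fixes v :: "real ^ 'n"
  assumes f: "lipschitz_spins v f"
  shows "\<bar>measure_pmf.expectation (ising_pmf L) f - measure_pmf.expectation (ising_pmf M) f\<bar>
    \<le> 2 * real CARD('n) * norm v"
proof -
  \<comment> \<open>A common reference point: both expectations lie within n \<parallel>v\<parallel>
    of f(x0). A crude bound suffices, since the iteration damps it by \<rho>^t.\<close>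
  define x0 :: "real ^ 'n" where "x0 = (\<chi> i. 1)"
  have x0: "x0 \<in> spins" by (simp add: x0_def spins_def)
  have dev: "\<bar>measure_pmf.expectation (ising_pmf J) f - f x0\<bar> \<le> real CARD('n) * norm v" for J
  proof -
    have "\<bar>f x - f x0\<bar> \<le> real CARD('n) * norm v" if "x \<in> spins" for x
    proof -
      have "\<bar>f x - f x0\<bar> \<le> (\<Sum>i\<in>UNIV. v $ i * of_bool (x $ i \<noteq> x0 $ i))"
        using f that x0 by (auto simp: lipschitz_spins_def)
      also have "\<dots> \<le> (\<Sum>i\<in>(UNIV :: 'n set). norm v)"
        using component_le_norm_cart[of v]
        by (intro sum_mono) (auto simp: abs_le_iff)
      finally show ?thesis by simp
    qed
    then have "\<bar>measure_pmf.expectation (ising_pmf J) (\<lambda>x. f x - f x0)\<bar> \<le> real CARD('n) * norm v"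
      by (rule abs_expectation_ising_le)
    then show ?thesis by simp
  qed
  show ?thesis using dev[of L] dev[of M] by linarith
qed

text \<open>Each measure is invariant under its own dynamics, so the difference is E_L(P f) - E_M(Q
  f); replacing Q by P inside E_M costs the last term.\<close>

lemma expectation_ising_diff_glauber:
  fixes L M :: "real ^ 'n ^ 'n"
  assumes L: "interaction_matrix L" and M: "interaction_matrix M" and f: "lipschitz_spins v f"
  shows "\<bar>measure_pmf.expectation (ising_pmf L) f - measure_pmf.expectation (ising_pmf M) f\<bar>
    \<le> \<bar>measure_pmf.expectation (ising_pmf L) (glauber L f) - measure_pmf.expectation (ising_pmf M) (glauber L f)\<bar>
      + spectral_norm (L - M) * sqrt (real CARD('n)) / (2 * real CARD('n)) * norm v"
proof -
  have "\<bar>measure_pmf.expectation (ising_pmf M) (\<lambda>x. glauber L f x - glauber M f x)\<bar>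
      \<le> spectral_norm (L - M) * sqrt (real CARD('n)) / (2 * real CARD('n)) * norm v"
    by (rule abs_expectation_ising_le) (rule glauber_diff_le[OF f])
  then show ?thesis
    using expectation_glauber[OF L, of f] expectation_glauber[OF M, of f] by simp
qed

theorem theorem4p2:
  fixes a :: "real ^ 'n" and f :: "real ^ 'n \<Rightarrow> real" and L M :: "real ^ 'n ^ 'n"
  assumes "\<And>i. a $ i > 0"
    and "lipschitz_spins a f"
    and "interaction_matrix L"
    and "spectral_norm (abs_matrix L) < 1"
    and "interaction_matrix M"
  shows "\<bar>measure_pmf.expectation (ising_pmf L) f - measure_pmf.expectation (ising_pmf M) f\<bar>
    \<le> norm a * sqrt (real CARD('n)) / (2 * (1 - spectral_norm (abs_matrix L)))
       * spectral_norm (L - M)"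
proof -
  let ?n = "real CARD('n)"
  define D where "D g = \<bar>measure_pmf.expectation (ising_pmf L) g - measure_pmf.expectation (ising_pmf M) g\<bar>"
    for g :: "real ^ 'n \<Rightarrow> real"
  define c where "c = spectral_norm (L - M) * sqrt ?n / (2 * ?n)"
  define \<rho> where "\<rho> = 1 - (1 - spectral_norm (abs_matrix L)) / ?n"
  have n: "?n \<ge> 1" by (simp add: Suc_leI)
  have c0: "c \<ge> 0" by (simp add: c_def spectral_norm_nonneg)
  have "(1 - spectral_norm (abs_matrix L)) / ?n \<le> 1"
    using n spectral_norm_nonneg[of "abs_matrix L"] by (subst divide_le_eq_1_pos) linarith+
  then have \<rho>: "0 \<le> \<rho>" "\<rho> < 1"
    using assms(4) by (auto simp: \<rho>_def)
  \<comment> \<open>The constant c/(1 - \<rho>) is the fixed point of K \<mapsto> \<rho> K + c; the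
    term with \<rho>^t carries the crude initial bound. Both g and v vary, since the step passes to
    \<open>glauber L g\<close> and \<open>?v\<close>.\<close>
  have iter: "D g \<le> (c / (1 - \<rho>) + \<rho> ^ t * (2 * ?n)) * norm v" if "lipschitz_spins v g" for t g v
    using that
  proof (induction t arbitrary: g v)
    case 0
    have "D g \<le> 2 * ?n * norm v"
      unfolding D_def by (rule expectation_ising_diff_crude[OF 0])
    also have "\<dots> \<le> (c / (1 - \<rho>) + 2 * ?n) * norm v"
      using c0 \<rho> by (intro mult_right_mono) auto
    finally show ?case by simp
  next
    case (Suc t)
    let ?v = "(1 / ?n) *\<^sub>R ((?n - 1) *\<^sub>R v + abs_matrix L *v v)"
    have "D g \<le> D (glauber L g) + c * norm v"
      unfolding D_def c_def by (rule expectation_ising_diff_glauber[OF assms(3,5) Suc.prems])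
    also have "D (glauber L g) \<le> (c / (1 - \<rho>) + \<rho> ^ t * (2 * ?n)) * norm ?v"
      by (rule Suc.IH) (rule lipschitz_spins_glauber[OF assms(3) Suc.prems])
    also have "\<dots> \<le> (c / (1 - \<rho>) + \<rho> ^ t * (2 * ?n)) * (\<rho> * norm v)"
      unfolding \<rho>_def using c0 \<rho>
      by (intro mult_left_mono norm_glauber_lipschitz_le) (auto simp flip: \<rho>_def)
    finally show ?case
      using \<rho> by (simp add: field_simps)
  qed
  have "(\<lambda>t. (c / (1 - \<rho>) + \<rho> ^ t * (2 * ?n)) * norm a) \<longlonglongrightarrow> (c / (1 - \<rho>) + 0 * (2 * ?n)) * norm a"
    using \<rho> by (intro tendsto_intros LIMSEQ_realpow_zero) auto
  then have "D f \<le> c / (1 - \<rho>) * norm a"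
    using iter[OF assms(2)] by (intro LIMSEQ_le_const) auto
  \<comment> \<open>Here 1 - \<rho> = (1 - \<parallel>|L|\<parallel>)/n, whose 1/n cancels the n in
    the denominator of c.\<close>
  also have "\<dots> = norm a * sqrt ?n / (2 * (1 - spectral_norm (abs_matrix L))) * spectral_norm (L - M)"
    using n assms(4) by (simp add: c_def \<rho>_def field_simps)
  finally show ?thesis by (simp add: D_def)
qed

end
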